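(* Let $\kappa\in\mathbb{C}$. Suppose that $(r_n)_{n\ge 1}$ is a sequence of positive real numbers such that $r_n\to\infty$ and $r_{n+1}\le\exp(r_n)+c$ for all $n$ and some $c>0$. Then there is an escaping endpoint $z\in I(E_\kappa)$ and some $n_0\in\mathbb{N}$ such that, for all $n\ge n_0$, $$|\operatorname{Re}(E_\kappa^{n-1}(z))-r_n|\le 2+2\pi.$$
   Context: For $\kappa\in\mathbb{C}$, $E_\kappa(z)=\exp(z)+\kappa$ and $I(E_\kappa)=\{z:E_\kappa^n(z)\to\infty\}$. Model. An external address is a sequence $\underline{s}=s_1s_2s_3\dots\in\mathbb{Z}^{\mathbb{N}}$; $\sigma$ is the shift. Let $F(t)=e^t-1$ on $[0,\infty)$, $\mathcal{F}(\underline{s},t)=(\sigma(\underline{s}),F(t)-2\pi|s_2|)$, $T(\underline{s},t)=t$, $Z(\underline{s},t)=t+2\pi i s_1$. Put $\overline{X}=\{(\underline{s},t)\in\mathbb{Z}^{\mathbb{N}}\times[0,\infty): T(\mathcal{F}^n(\underline{s},t))\ge 0\ \forall n\ge 0\}$ and $X=\{(\underline{s},t)\in\overline{X}:T(\mathcal{F}^n(\underline{s},t))\to\infty\}$. For each $\underline{s}$ there is $t_{\underline{s}}\in[0,\infty]$ with $\{t:(\underline{s},t)\in\overline{X}\}=[t_{\underline{s}},\infty)$. An address with $t_{\underline{s}}<\infty$ is exponentially bounded; it is fast if moreover $(\underline{s},t_{\underline{s}})\in X$. The map $\mathfrak{g}$. Choose $K>2\pi+6$ with $|\kappa|\le K$,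 let $Q=\max\{\log(4(K+\pi+3)),\pi+2\}$ and $Y=\{(\underline{s},t)\in\overline{X}:T(\mathcal{F}^n(\underline{s},t))\ge Q\ \forall n\ge 0\}$. Let $L_k(w)=\operatorname{Log}(w-\kappa)+2\pi i k$ (principal branch), $\mathfrak{g}_0=Z$, $\mathfrak{g}_{k+1}(\underline{s},t)=L_{s_1}(\mathfrak{g}_k(\mathcal{F}(\underline{s},t)))$. On $Y$ the $\mathfrak{g}_k$ converge uniformly to a map $\mathfrak{g}$ with $\mathfrak{g}\circ\mathcal{F}=E_\kappa\circ\mathfrak{g}$. The restriction $\mathfrak{g}|_{Y\cap X}$ extends uniquely to a map with $\mathfrak{g}\circ\mathcal{F}=E_\kappa\circ\mathfrak{g}$ that is continuous in $t$ along each $\{\underline{s}\}\times\{t: (\underline s,t)\in X\}$ and is defined on all of $X$ if $\kappa\notin I(E_\kappa)$; if $\kappa\in I(E_\kappa)$ then there is $(\underline{s}^0,t^0)\in X$ with $\mathfrak{g}(\underline{s}^0,t^0)=\kappa$, and $\mathfrak{g}$ is defined on all of $X$ except the points $(\underline{s},t)$ with $\mathcal{F}^n(\underline{s},t)=(\underline{s}^0,t')$ for some $n\ge1$, $t'\le t^0$. An escaping endpoint is a point of the form $\mathfrak{g}(\underline{s},t_{\underline{s}})$ where $\underline{s}$ is a fast address for which this is defined (it is the endpoint of the dynamic ray $t\mapsto\mathfrak{g}(\underline{s},t+t_{\underline{s}})$, $t>0$). *)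

theory Defs
  imports "HOL-Analysis.Analysis"
begin

definition E :: "complex \<Rightarrow> complex \<Rightarrow> complex"
  where "E \<kappa> z = exp z + \<kappa>"

definition escaping_set :: "complex \<Rightarrow> complex set"
  where "escaping_set \<kappa> = {z. filterlim (\<lambda>n. (E \<kappa> ^^ n) z) at_infinity sequentially}"

text \<open>
  External addresses are indexed from 0 here: the entry written \<open>s\<^sub>j\<close> (with \<open>j \<ge> 1\<close>) in the
  mathematical notation is \<open>s (j - 1)\<close>; in particular \<open>s\<^sub>1 = s 0\<close> and \<open>s\<^sub>2 = s 1\<close>.
\<close>

type_synonym address = "nat \<Rightarrow> int"

definition shift :: "address \<Rightarrow> address"
  where "shift s = (\<lambda>j. s (Suc j))"

definition F :: "real \<Rightarrow> real"
  where "F t = exp t - 1"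

text \<open>
  The model map is total on \<open>address \<times> real\<close>. The model spaces below require every point of an
  orbit to have non-negative second component, so only the values of \<open>F\<close> on \<open>[0,\<infinity>)\<close> matter.
\<close>

definition model :: "address \<times> real \<Rightarrow> address \<times> real"
  where "model p = (shift (fst p), F (snd p) - 2 * pi * \<bar>real_of_int (fst p 1)\<bar>)"

definition T :: "address \<times> real \<Rightarrow> real"
  where "T p = snd p"

definition Z :: "address \<times> real \<Rightarrow> complex"
  where "Z p = complex_of_real (snd p) + 2 * complex_of_real pi * \<i> * of_int (fst p 0)"

definition X_bar :: "(address \<times> real) set"
  where "X_bar = {p. \<forall>n. T ((model ^^ n) p) \<ge> 0}"

definition X :: "(address \<times> real) set"
  where "X = {p \<in> X_bar. filterlim (\<lambda>n. T ((model ^^ n) p)) at_top sequentially}"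

text \<open>\<open>t_min s\<close> is \<open>\<infinity>\<close> if no point of \<open>X_bar\<close> has address \<open>s\<close>.\<close>

definition t_min :: "address \<Rightarrow> ereal"
  where "t_min s = Inf (ereal ` {t. (s, t) \<in> X_bar})"

definition exponentially_bounded :: "address \<Rightarrow> bool"
  where "exponentially_bounded s \<longleftrightarrow> t_min s < \<infinity>"

definition fast :: "address \<Rightarrow> bool"
  where "fast s \<longleftrightarrow> exponentially_bounded s \<and> (s, real_of_ereal (t_min s)) \<in> X"

definition Q :: "real \<Rightarrow> real"
  where "Q K = max (ln (4 * (K + pi + 3))) (pi + 2)"

definition Y :: "real \<Rightarrow> (address \<times> real) set"
  where "Y K = {p \<in> X_bar. \<forall>n. T ((model ^^ n) p) \<ge> Q K}"

definition L :: "complex \<Rightarrow> int \<Rightarrow> complex \<Rightarrow> complex"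
  where "L \<kappa> k w = Ln (w - \<kappa>) + 2 * complex_of_real pi * \<i> * of_int k"

primrec g_approx :: "complex \<Rightarrow> nat \<Rightarrow> address \<times> real \<Rightarrow> complex"
  where
    "g_approx \<kappa> 0 p = Z p"
  | "g_approx \<kappa> (Suc k) p = L \<kappa> (fst p 0) (g_approx \<kappa> k (model p))"

text \<open>
  \<open>g_extension \<kappa> K D h\<close>: on \<open>D\<close>, the function \<open>h\<close> is an extension of
  \<open>lim\<^sub>k g_approx \<kappa> k\<close> from \<open>Y K \<inter> X\<close> that satisfies the functional equation and is continuous
  along rays. Any two such extensions agree wherever both are defined: along a ray,
  they agree for all large potentials, and \<open>D\<close> contains the ray from each of its points upwards,
  on which both are lifts of the same curve under an iterate of the local homeomorphism \<open>E \<kappa>\<close>.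
\<close>

definition g_extension ::
    "complex \<Rightarrow> real \<Rightarrow> (address \<times> real) set \<Rightarrow> (address \<times> real \<Rightarrow> complex) \<Rightarrow> bool"
  where "g_extension \<kappa> K D h \<longleftrightarrow>
    Y K \<inter> X \<subseteq> D \<and> D \<subseteq> X \<and>
    (\<forall>s t t'. (s, t) \<in> D \<longrightarrow> t \<le> t' \<longrightarrow> (s, t') \<in> D) \<and>
    (\<forall>p \<in> Y K \<inter> X. (\<lambda>k. g_approx \<kappa> k p) \<longlonglongrightarrow> h p) \<and>
    (\<forall>p \<in> D. model p \<in> D \<and> h (model p) = E \<kappa> (h p)) \<and>
    (\<forall>s. continuous_on {t. (s, t) \<in> D} (\<lambda>t. h (s, t)))"

text \<open>
  The extended map \<open>g\<close> as a partial function: \<open>g_at \<kappa> K p w\<close> says that \<open>g\<close> is defined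
  at \<open>p\<close> with value \<open>w\<close>. By the uniqueness just explained there is at most one such \<open>w\<close>.
\<close>

definition g_at :: "complex \<Rightarrow> real \<Rightarrow> address \<times> real \<Rightarrow> complex \<Rightarrow> bool"
  where "g_at \<kappa> K p w \<longleftrightarrow> (\<exists>D h. g_extension \<kappa> K D h \<and> p \<in> D \<and> h p = w)"

text \<open>
  The domain of \<open>g\<close>. If the singular value \<open>\<kappa>\<close> escapes and \<open>g (s0, t0) = \<kappa>\<close>, continuation
  of \<open>g\<close> down a ray breaks off at each preimage of \<open>(s0, t0)\<close>, since \<open>E \<kappa>\<close> omits \<open>\<kappa>\<close>.
\<close>

definition g_dom :: "complex \<Rightarrow> real \<Rightarrow> (address \<times> real) set"
  where "g_dom \<kappa> K =
    (if \<kappa> \<notin> escaping_set \<kappa> then X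
     else X - {p. \<exists>s0 t0. (s0, t0) \<in> X \<and> g_at \<kappa> K (s0, t0) \<kappa> \<and>
                   (\<exists>n \<ge> 1. \<exists>t'. (model ^^ n) p = (s0, t') \<and> t' \<le> t0)})"

definition escaping_endpoint :: "complex \<Rightarrow> real \<Rightarrow> complex \<Rightarrow> bool"
  where "escaping_endpoint \<kappa> K z \<longleftrightarrow>
    (\<exists>s. fast s \<and> (s, real_of_ereal (t_min s)) \<in> g_dom \<kappa> K \<and>
         g_at \<kappa> K (s, real_of_ereal (t_min s)) z)"

end

theory Submission
  imports Defs
begin

text \<open>
  The address is chosen so that the whole model orbit of its endpoint stays in \<open>Y K\<close>; there
  \<open>g\<close> is simply the uniform limit of \<open>g_approx\<close>, and \<open>Y K \<inter> X\<close> itself serves as the domain of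
  an extension. On \<open>Y K\<close> the limit differs from \<open>Z\<close> by at most \<open>1\<close> in the real and \<open>\<pi>\<close> in the
  imaginary part.

  From some index on, the entries are chosen greedily, placing the potential \<open>t\<^sub>m\<close> in a window of
  length \<open>2\<pi>\<close> above \<open>r\<^sub>m\<^sub>+\<^sub>1 + 1\<close>. The margin \<open>1\<close> gives \<open>t\<^sub>m\<^sub>+\<^sub>1 \<le> exp t\<^sub>m / 2\<close>, whence no smaller
  initial potential has an orbit in \<open>[0,\<infinity>)\<close>, that is, the point is an endpoint. Before that index,
  zero entries and a huge initial potential keep the orbit above \<open>Q K\<close>; the first greedy
  entry absorbs the excess.

  If \<open>g (s0, t0) = \<kappa>\<close>, the imaginary parts of the orbit of \<open>\<kappa>\<close> determine the entries of \<open>s0\<close>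
  eventually up to an error of \<open>1/2\<close>. As the entries of \<open>s\<close> are eventually at least \<open>2\<close>, the
  addresses \<open>s\<close> and \<open>-s\<close> cannot both have a shift equal to such an \<open>s0\<close>, so one of
  the two endpoints lies in the domain of \<open>g\<close>.
\<close>

section \<open>Orbits of the model map\<close>

lemma fst_model_funpow: "fst ((model ^^ n) p) j = fst p (n + j)"
  by (induction n arbitrary: j) (auto simp: model_def shift_def)

lemma T_model_funpow_Suc:
  "T ((model ^^ Suc n) p) = exp (T ((model ^^ n) p)) - 1 - 2 * pi * \<bar>real_of_int (fst p (Suc n))\<bar>"
  using fst_model_funpow[of n p 1] by (simp add: model_def T_def F_def)

lemma T_model_funpow_mono:
  assumes "t \<le> t'"
  shows "T ((model ^^ n) (s, t)) \<le> T ((model ^^ n) (s, t'))"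
proof (induction n)
  case 0
  then show ?case using assms by (simp add: T_def)
next
  case (Suc n)
  then show ?case unfolding T_model_funpow_Suc by simp
qed

lemma funpow_model_model: "(model ^^ n) (model p) = (model ^^ Suc n) p"
  by (simp add: funpow_swap1)

lemma X_bar_model: "p \<in> X_bar \<Longrightarrow> model p \<in> X_bar"
  unfolding X_bar_def by (auto simp: funpow_model_model simp del: funpow.simps)

lemma X_model: "p \<in> X \<Longrightarrow> model p \<in> X"
  unfolding X_def using filterlim_sequentially_Suc[of "\<lambda>n. T ((model ^^ n) p)" at_top]
  by (auto simp: funpow_model_model X_bar_model simp del: funpow.simps)

lemma Y_model: "p \<in> Y K \<Longrightarrow> model p \<in> Y K"
  unfolding Y_def using X_bar_model by (auto simp: funpow_model_model simp del: funpow.simps)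

lemma Y_upward_closed: "(s, t) \<in> Y K \<Longrightarrow> t \<le> t' \<Longrightarrow> (s, t') \<in> Y K"
  unfolding Y_def X_bar_def using T_model_funpow_mono order_trans by blast

lemma X_upward_closed:
  assumes "(s, t) \<in> X" "t \<le> t'"
  shows "(s, t') \<in> X"
proof -
  have "filterlim (\<lambda>n. T ((model ^^ n) (s, t'))) at_top sequentially"
    by (rule filterlim_at_top_mono[of "\<lambda>n. T ((model ^^ n) (s, t))"])
       (use assms T_model_funpow_mono in \<open>auto simp: X_def\<close>)
  moreover have "(s, t') \<in> X_bar"
    using assms T_model_funpow_mono order_trans unfolding X_def X_bar_def by blast
  ultimately show ?thesis by (simp add: X_def)
qed

text \<open>On \<open>Y K \<inter> X\<close> every extension must equal the limit of
  \<open>g_approx\<close>; this makes that information available along the tail of any escaping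
  model orbit.\<close>

lemma X_eventually_Y:
  assumes "p \<in> X"
  shows "\<forall>\<^sub>F n in sequentially. (model ^^ n) p \<in> Y K \<inter> X"
proof -
  have X: "(model ^^ n) p \<in> X" for n
    by (induction n) (auto simp: assms X_model)
  have "\<forall>\<^sub>F n in sequentially. Q K \<le> T ((model ^^ n) p)"
    using assms by (auto simp: X_def filterlim_at_top)
  then obtain m where m: "Q K \<le> T ((model ^^ n) p)" if "n \<ge> m" for n
    by (auto simp: eventually_sequentially)
  have "(model ^^ n) p \<in> Y K" if "n \<ge> m" for n
    unfolding Y_def using X[of n] m[of "i + n" for i] that
    by (auto simp: X_def funpow_add)
  then show ?thesis
    using X by (auto simp: eventually_sequentially)
qed

section \<open>Boxes around \<open>Z\<close> and convergence of \<open>g_approx\<close> on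
  \<open>Y K\<close>\<close>

definition box_around :: "complex \<Rightarrow> complex set"
  where "box_around \<zeta> = {u. \<bar>Re u - Re \<zeta>\<bar> \<le> 1 \<and> \<bar>Im u - Im \<zeta>\<bar> \<le> pi}"

lemma box_around_eq: "box_around \<zeta> = cbox (\<zeta> - Complex 1 pi) (\<zeta> + Complex 1 pi)"
  by (auto simp: box_around_def in_cbox_complex_iff abs_le_iff)

lemma closed_box_around: "closed (box_around \<zeta>)"
  and convex_box_around: "convex (box_around \<zeta>)"
  by (simp_all add: box_around_eq closed_cbox convex_box)

lemma exp_1_ge: "exp (1::real) \<ge> 5/2"
  using exp_lower_Taylor_quadratic[of "1::real"] by simp

context
  fixes \<kappa> :: complex and K :: real
  assumes K: "K > 2 * pi + 6" and \<kappa>: "cmod \<kappa> \<le> K"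
begin

lemma Y_exp_bound:
  assumes "p \<in> Y K"
  shows "exp (T p) \<ge> 4 * K + 4 * pi + 12"
proof -
  have "0 < K + pi + 3"
    using K pi_gt_zero by linarith
  then have pos: "0 < 4 * (K + pi + 3)"
    by simp
  have "T p \<ge> Q K"
    using assms unfolding Y_def by (auto dest: spec[of _ 0])
  then have "ln (4 * (K + pi + 3)) \<le> T p"
    by (simp add: Q_def)
  then show ?thesis
    using exp_le_cancel_iff[of "ln (4 * (K + pi + 3))" "T p"] pos
    by (simp add: exp_ln del: exp_le_cancel_iff)
qed

text \<open>The modulus of \<open>Z (model p)\<close> is comparable to \<open>exp (T p)\<close>,
  whereas the box and the translation by \<kappa> together move it by at most
  \<open>1 + pi + K\<close>, less than a quarter of \<open>exp (T p)\<close>.\<close>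

lemma shifted_box_bounds:
  assumes p: "p \<in> Y K" and u: "u \<in> box_around (Z (model p))"
  shows "exp (T p - 1) \<le> cmod (u - \<kappa>)" "cmod (u - \<kappa>) \<le> exp (T p + 1)"
    and "2 \<le> cmod (u - \<kappa>)" "u - \<kappa> \<notin> \<real>\<^sub>\<le>\<^sub>0"
proof -
  define e where "e = exp (T p)"
  define \<zeta> where "\<zeta> = Z (model p)"
  have e: "e \<ge> 4 * K + 4 * pi + 12"
    using Y_exp_bound[OF p] by (simp add: e_def)
  have "T (model p) \<ge> 0"
    using Y_model[OF p] unfolding Y_def X_bar_def by (auto dest: spec[of _ 0])
  then have Re0: "Re \<zeta> \<ge> 0"
    by (simp add: \<zeta>_def Z_def T_def)
  \<comment> \<open>The amount \<open>2 * pi * \<bar>s_2\<bar>\<close> subtracted by the model map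
    is exactly the absolute imaginary part of \<zeta>.\<close>
  have Re_Im: "Re \<zeta> + \<bar>Im \<zeta>\<bar> = e - 1"
    by (simp add: \<zeta>_def Z_def model_def F_def e_def T_def shift_def abs_mult)
  have dRe: "\<bar>Re u - Re \<zeta>\<bar> \<le> 1" and dIm: "\<bar>Im u - Im \<zeta>\<bar> \<le> pi"
    using u by (auto simp: box_around_def \<zeta>_def)
  have "cmod (u - \<zeta>) \<le> 1 + pi"
    using cmod_le[of "u - \<zeta>"] dRe dIm by simp
  moreover have "cmod (u - \<kappa> - \<zeta>) \<le> cmod (u - \<zeta>) + cmod \<kappa>"
    using norm_triangle_ineq4[of "u - \<zeta>" \<kappa>] by (simp add: algebra_simps)
  ultimately have d: "cmod (u - \<kappa> - \<zeta>) \<le> 1 + pi + K"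
    using \<kappa> by linarith
  have up: "cmod \<zeta> \<le> e - 1"
    using cmod_le[of \<zeta>] Re0 Re_Im by simp
  have "sqrt 2 \<le> 3/2"
    by (rule real_le_lsqrt) (auto simp: power2_eq_square)
  then have "sqrt 2 * cmod \<zeta> \<le> 3/2 * cmod \<zeta>"
    by (rule mult_right_mono) simp
  then have low: "e - 1 \<le> 3/2 * cmod \<zeta>"
    using complex_abs_le_norm[of \<zeta>] Re0 Re_Im by simp
  have lo: "cmod (u - \<kappa>) \<ge> cmod \<zeta> - (1 + pi + K)"
    using norm_triangle_ineq2[of \<zeta> "\<zeta> - (u - \<kappa>)"] d norm_minus_commute[of \<zeta> "u - \<kappa>"] by simp
  have hi: "cmod (u - \<kappa>) \<le> cmod \<zeta> + (1 + pi + K)"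
    using norm_triangle_ineq[of \<zeta> "u - \<kappa> - \<zeta>"] d by simp
  have e0: "e > 0" by (simp add: e_def)
  have "e = exp (T p - 1) * exp 1"
    by (simp add: e_def flip: exp_add)
  also have "\<dots> \<ge> exp (T p - 1) * (5/2)"
    using exp_1_ge by (intro mult_left_mono) auto
  finally have "exp (T p - 1) \<le> 2/5 * e"
    by simp
  \<comment> \<open>By \<open>low\<close>, \<zeta> has modulus at least
    \<open>2/3 * (e - 1)\<close>; subtracting at most \<open>e/4 - 2\<close> leaves more than
    \<open>5/12 * e\<close>.\<close>
  also have "2/5 * e \<le> cmod (u - \<kappa>)"
    using lo low e e0 by (simp add: field_simps)
  finally show "exp (T p - 1) \<le> cmod (u - \<kappa>)" .
  have "e * (5/2) \<le> exp (T p + 1)"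
    unfolding e_def exp_add using exp_1_ge by (intro mult_left_mono) auto
  then show "cmod (u - \<kappa>) \<le> exp (T p + 1)"
    using hi up e e0 by (simp add: field_simps)
  show "2 \<le> cmod (u - \<kappa>)"
    using lo low e K pi_gt_zero by linarith
  \<comment> \<open>On the slit, \<open>Re \<zeta>\<close> is at most \<open>K + 1\<close> and
    \<open>\<bar>Im \<zeta>\<bar>\<close> at most \<open>K + pi\<close>, too little for their sum
    \<open>e - 1\<close>.\<close>
  show "u - \<kappa> \<notin> \<real>\<^sub>\<le>\<^sub>0"
  proof
    assume "u - \<kappa> \<in> \<real>\<^sub>\<le>\<^sub>0"
    then have "Im u = Im \<kappa>" "Re u \<le> Re \<kappa>"
      by (auto simp: complex_nonpos_Reals_iff)
    then show False
      using dRe dIm Re_Im e abs_Re_le_cmod[of \<kappa>] abs_Im_le_cmod[of \<kappa>] \<kappa> K pi_gt_zero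
      by linarith
  qed
qed

text \<open>This dictates the size of the boxes: \<open>Ln\<close> turns the factor
  \<open>exp 1\<close> in the modulus into an error 1 in the real part, and the principal argument
  is at most \<open>pi\<close> in absolute value.\<close>

lemma L_in_box_around:
  assumes p: "p \<in> Y K" and u: "u \<in> box_around (Z (model p))"
  shows "L \<kappa> (fst p 0) u \<in> box_around (Z p)"
proof -
  note b = shifted_box_bounds[OF assms]
  have nz: "u - \<kappa> \<noteq> 0" using b(3) by auto
  have "ln (exp (T p - 1)) \<le> ln (cmod (u - \<kappa>))" "ln (cmod (u - \<kappa>)) \<le> ln (exp (T p + 1))"
    using b nz by (subst ln_le_cancel_iff; simp)+
  moreover have "\<bar>Im (Ln (u - \<kappa>))\<bar> \<le> pi"
    using nz Im_Ln_le_pi mpi_less_Im_Ln[of "u - \<kappa>"] by (simp add: abs_le_iff)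
  ultimately show ?thesis
    using nz by (auto simp: L_def box_around_def Z_def T_def abs_le_iff)
qed

lemma g_approx_in_box_around: "p \<in> Y K \<Longrightarrow> g_approx \<kappa> k p \<in> box_around (Z p)"
proof (induction k arbitrary: p)
  case 0
  then show ?case by (simp add: box_around_def)
next
  case (Suc k)
  then show ?case using L_in_box_around Y_model by simp
qed

text \<open>The derivative \<open>1 / (w - \<kappa>)\<close> has modulus at most \<open>1/2\<close>
  on the box, which is convex and avoids the slit.\<close>

lemma L_contracting:
  assumes p: "p \<in> Y K"
    and u: "u \<in> box_around (Z (model p))" and v: "v \<in> box_around (Z (model p))"
  shows "cmod (L \<kappa> k u - L \<kappa> k v) \<le> cmod (u - v) / 2"
proof -
  let ?B = "box_around (Z (model p))"
  have "cmod (L \<kappa> k u - L \<kappa> k v) \<le> 1/2 * cmod (u - v)"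
  proof (rule field_differentiable_bound[OF convex_box_around _ _ u v])
    fix w assume w: "w \<in> ?B"
    note b = shifted_box_bounds[OF p w]
    show "(L \<kappa> k has_field_derivative inverse (w - \<kappa>)) (at w within ?B)"
      unfolding L_def by (auto intro!: derivative_eq_intros b)
    have "cmod (inverse (w - \<kappa>)) \<le> inverse 2"
      using b(3) by (subst norm_inverse, intro le_imp_inverse_le) auto
    then show "cmod (inverse (w - \<kappa>)) \<le> 1/2" by simp
  qed
  then show ?thesis by simp
qed

text \<open>The initial displacement is at most \<open>1 + pi\<close> by the box, and each of the
  \<open>k\<close> pullbacks halves it.\<close>

lemma g_approx_diff:
  "p \<in> Y K \<Longrightarrow> cmod (g_approx \<kappa> (Suc k) p - g_approx \<kappa> k p) \<le> (1 + pi) * (1/2) ^ k"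
proof (induction k arbitrary: p)
  case 0
  have "g_approx \<kappa> (Suc 0) p \<in> box_around (Z p)"
    using g_approx_in_box_around 0 by blast
  then show ?case
    using cmod_le[of "g_approx \<kappa> (Suc 0) p - Z p"] by (auto simp: box_around_def)
next
  case (Suc k)
  have "cmod (g_approx \<kappa> (Suc (Suc k)) p - g_approx \<kappa> (Suc k) p)
      \<le> cmod (g_approx \<kappa> (Suc k) (model p) - g_approx \<kappa> k (model p)) / 2"
    using L_contracting[OF Suc.prems g_approx_in_box_around g_approx_in_box_around] 
      Y_model[OF Suc.prems] by (simp del: g_approx.simps add: g_approx.simps(2)[of _ "Suc k"]
        g_approx.simps(2)[of _ k p])
  also have "\<dots> \<le> (1 + pi) * (1/2) ^ k / 2"
    using Suc.IH[OF Y_model[OF Suc.prems]] by simp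
  finally show ?case by simp
qed

text \<open>The limit is written as a telescoping series so that the Weierstrass M-test yields
  uniform convergence and hence continuity along rays.\<close>

definition g_lim :: "address \<times> real \<Rightarrow> complex"
  where "g_lim p = Z p + (\<Sum>k. g_approx \<kappa> (Suc k) p - g_approx \<kappa> k p)"

lemma g_approx_uniform_limit: "uniform_limit (Y K) (g_approx \<kappa>) g_lim sequentially"
proof -
  have "uniform_limit (Y K) (\<lambda>n p. Z p + (\<Sum>k<n. g_approx \<kappa> (Suc k) p - g_approx \<kappa> k p))
      g_lim sequentially"
    unfolding g_lim_def
    by (intro uniform_limit_intros Weierstrass_m_test[where M = "\<lambda>k. (1 + pi) * (1/2) ^ k"])
       (auto intro: g_approx_diff simp del: g_approx.simps)
  moreover have "Z p + (\<Sum>k<n. g_approx \<kappa> (Suc k) p - g_approx \<kappa> k p) = g_approx \<kappa> n p" for n p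
    by (subst sum_lessThan_telescope) simp
  ultimately show ?thesis by simp
qed

lemma g_approx_tendsto: "p \<in> Y K \<Longrightarrow> (\<lambda>k. g_approx \<kappa> k p) \<longlonglongrightarrow> g_lim p"
  using tendsto_uniform_limitI[OF g_approx_uniform_limit] .

lemma g_lim_in_box_around: "p \<in> Y K \<Longrightarrow> g_lim p \<in> box_around (Z p)"
  by (rule closed_sequentially[OF closed_box_around _ g_approx_tendsto])
     (auto intro: g_approx_in_box_around)

lemma g_lim_model:
  assumes p: "p \<in> Y K"
  shows "g_lim (model p) = E \<kappa> (g_lim p)"
proof -
  have "E \<kappa> (g_approx \<kappa> (Suc k) p) = g_approx \<kappa> k (model p)" for k
  proof -
    have "g_approx \<kappa> k (model p) - \<kappa> \<noteq> 0"
      using shifted_box_bounds(3)[OF p g_approx_in_box_around[OF Y_model[OF p]], of k] by auto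
    moreover have "exp (2 * complex_of_real pi * \<i> * of_int (fst p 0)) = 1"
      using exp_integer_2pi[of "of_int (fst p 0)"] by (simp add: mult_ac)
    ultimately show ?thesis
      by (simp add: E_def L_def exp_add)
  qed
  moreover have "(\<lambda>k. E \<kappa> (g_approx \<kappa> (Suc k) p)) \<longlonglongrightarrow> E \<kappa> (g_lim p)"
    unfolding E_def by (intro tendsto_intros LIMSEQ_Suc g_approx_tendsto p)
  ultimately show ?thesis
    using g_approx_tendsto[OF Y_model[OF p]] LIMSEQ_unique by auto
qed

lemma continuous_on_g_approx:
  "continuous_on {t. (s, t) \<in> Y K} (\<lambda>t. g_approx \<kappa> k (s, t))"
proof (induction k arbitrary: s)
  case 0
  then show ?case by (auto simp: Z_def intro!: continuous_intros)
next
  case (Suc k)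
  let ?f = "\<lambda>t. F t - 2 * pi * \<bar>real_of_int (s 1)\<bar>"
  have Ym: "(shift s, ?f t) \<in> Y K" if "(s, t) \<in> Y K" for t
    using Y_model[OF that] by (simp add: model_def)
  have "continuous_on {t. (s, t) \<in> Y K} (\<lambda>t. g_approx \<kappa> k (shift s, ?f t))"
    by (rule continuous_on_compose2[OF Suc])
       (use Ym in \<open>auto simp: F_def intro!: continuous_intros\<close>)
  moreover have "g_approx \<kappa> k (shift s, ?f t) - \<kappa> \<notin> \<real>\<^sub>\<le>\<^sub>0" if "(s, t) \<in> Y K" for t
    using shifted_box_bounds(4)[OF that g_approx_in_box_around[OF Y_model[OF that]]]
    by (simp add: model_def)
  ultimately show ?case
    by (auto simp: L_def model_def intro!: continuous_intros)
qed

lemma continuous_on_g_lim: "continuous_on {t. (s, t) \<in> Y K} (\<lambda>t. g_lim (s, t))"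
proof (rule uniform_limit_theorem)
  show "uniform_limit {t. (s, t) \<in> Y K} (\<lambda>k t. g_approx \<kappa> k (s, t)) (\<lambda>t. g_lim (s, t)) sequentially"
    using g_approx_uniform_limit unfolding uniform_limit_iff by (force elim: eventually_mono)
qed (use continuous_on_g_approx in simp_all)

text \<open>\<open>Y K \<inter> X\<close> is forward invariant and closed upwards along rays, so it
  is an admissible domain.\<close>

lemma g_extension_g_lim: "g_extension \<kappa> K (Y K \<inter> X) g_lim"
  unfolding g_extension_def
  by (auto intro: Y_upward_closed X_upward_closed g_approx_tendsto Y_model X_model g_lim_model
      continuous_on_subset[OF continuous_on_g_lim])

lemma g_at_g_lim: "p \<in> Y K \<inter> X \<Longrightarrow> g_at \<kappa> K p (g_lim p)"
  using g_extension_g_lim unfolding g_at_def by blast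

lemma g_lim_funpow_model:
  assumes "p \<in> Y K"
  shows "(E \<kappa> ^^ n) (g_lim p) = g_lim ((model ^^ n) p)" "(model ^^ n) p \<in> Y K"
  using assms by (induction n) (auto simp: Y_model g_lim_model)

lemma g_lim_in_escaping_set:
  assumes p: "p \<in> Y K \<inter> X"
  shows "g_lim p \<in> escaping_set \<kappa>"
proof -
  have "T ((model ^^ n) p) - 1 \<le> cmod ((E \<kappa> ^^ n) (g_lim p))" for n
    using g_lim_in_box_around[of "(model ^^ n) p"] g_lim_funpow_model[of p n] p
      complex_Re_le_cmod[of "(E \<kappa> ^^ n) (g_lim p)"]
    by (auto simp: box_around_def Z_def T_def)
  moreover have "filterlim (\<lambda>n. T ((model ^^ n) p) - 1) at_top sequentially"
    using p filterlim_tendsto_add_at_top[OF tendsto_const[of "-1"], of "\<lambda>n. T ((model ^^ n) p)"]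
    by (simp add: X_def)
  ultimately show ?thesis
    unfolding escaping_set_def
    by (auto intro!: filterlim_norm_at_top_imp_at_infinity intro: filterlim_at_top_mono)
qed

text \<open>On the tail of the orbit \<open>h\<close> coincides with \<open>g_lim\<close>, whose box
  has half-height \<open>pi\<close> around the imaginary part \<open>2 * pi * s_j\<close>. As
  \<open>D\<close> and \<open>h\<close> are arbitrary, this applies to every point at which the
  value \<kappa> is attained.\<close>

lemma g_at_itinerary:
  assumes g: "g_at \<kappa> K p w"
  shows "\<forall>\<^sub>F j in sequentially. \<bar>Im ((E \<kappa> ^^ j) w) - 2 * pi * real_of_int (fst p j)\<bar> \<le> pi"
proof -
  obtain D h where D: "g_extension \<kappa> K D h" "p \<in> D" "h p = w"
    using g by (auto simp: g_at_def)
  have orbit: "(model ^^ j) p \<in> D \<and> h ((model ^^ j) p) = (E \<kappa> ^^ j) w" for j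
    using D by (induction j) (auto simp: g_extension_def)
  have "p \<in> X" using D by (auto simp: g_extension_def)
  show ?thesis
    using X_eventually_Y[OF \<open>p \<in> X\<close>, of K]
  proof eventually_elim
    case (elim j)
    then have "h ((model ^^ j) p) = g_lim ((model ^^ j) p)"
      using D(1) g_approx_tendsto LIMSEQ_unique unfolding g_extension_def by blast
    then show ?case
      using orbit[of j] g_lim_in_box_around[of "(model ^^ j) p"] elim fst_model_funpow[of j p 0]
      by (auto simp: box_around_def Z_def)
  qed
qed

end

section \<open>A criterion for endpoints\<close>

lemma t_min_eq:
  assumes "(s, t) \<in> X_bar" and "\<And>t'. t' < t \<Longrightarrow> (s, t') \<notin> X_bar"
  shows "t_min s = ereal t"
  unfolding t_min_def
proof (rule antisym)
  show "Inf (ereal ` {t. (s, t) \<in> X_bar}) \<le> ereal t"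
    using assms(1) by (auto intro: Inf_lower)
  show "ereal t \<le> Inf (ereal ` {t. (s, t) \<in> X_bar})"
    using assms(2) by (intro Inf_greatest) (auto simp: not_less[symmetric])
qed

text \<open>With a common address the entries cancel in the difference of potentials, and
  \<open>F\<close> expands it.\<close>

lemma diff_potential_unbounded:
  assumes X: "(s, t') \<in> X_bar" and less: "t' < t"
  shows "\<forall>\<^sub>F n in sequentially. T ((model ^^ n) (s, t)) - T ((model ^^ n) (s, t')) \<ge> 1"
proof -
  define d where "d n = T ((model ^^ n) (s, t)) - T ((model ^^ n) (s, t'))" for n
  have d0: "d 0 > 0"
    using less by (simp add: d_def T_def)
  have step: "d n + (d n)\<^sup>2 / 2 \<le> d (Suc n)" if "d n \<ge> 0" for n
  proof -
    let ?b = "T ((model ^^ n) (s, t'))"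
    have "d (Suc n) = exp (?b + d n) - exp ?b"
      unfolding d_def T_model_funpow_Suc by simp
    also have "\<dots> = (exp (d n) - 1) * exp ?b"
      by (simp add: exp_add algebra_simps)
    \<comment> \<open>The lower orbit lies in \<open>X_bar\<close>, so its potential is non-negative
      and \<open>exp ?b\<close> is at least 1.\<close>
    also have "\<dots> \<ge> (exp (d n) - 1) * 1"
      using X that by (intro mult_left_mono) (auto simp: X_bar_def)
    finally show ?thesis
      using exp_lower_Taylor_quadratic[OF that] by simp
  qed
  have "d n \<ge> d 0 + n * ((d 0)\<^sup>2 / 2)" for n
  proof (induction n)
    case (Suc n)
    have "0 \<le> n * ((d 0)\<^sup>2 / 2)" by simp
    then have "d n \<ge> d 0" using Suc by linarith
    then have "(d 0)\<^sup>2 \<le> (d n)\<^sup>2" "d n \<ge> 0"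
      using d0 by (auto intro: power_mono)
    then show ?case
      using step[of n] Suc by (simp add: algebra_simps add_divide_distrib)
  qed simp
  moreover have "filterlim (\<lambda>n. d 0 + real n * ((d 0)\<^sup>2 / 2)) at_top sequentially"
    using d0 by (intro filterlim_tendsto_add_at_top[OF tendsto_const]
        filterlim_at_top_mult_tendsto_pos[OF tendsto_const] filterlim_real_sequentially) auto
  ultimately have "filterlim d at_top sequentially"
    by (auto intro: filterlim_at_top_mono)
  then show ?thesis
    by (auto simp: filterlim_at_top d_def)
qed

text \<open>Once the potentials differ by at least 1, the lower exponential is less than half the
  upper one. The next entry removes at least half of the upper exponential, so the lower potential
  becomes negative.\<close>

lemma not_X_bar_below:
  assumes less: "t' < t"
    and half: "\<forall>\<^sub>F n in sequentially.
      T ((model ^^ Suc n) (s, t)) \<le> exp (T ((model ^^ n) (s, t))) / 2"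
  shows "(s, t') \<notin> X_bar"
proof
  assume X: "(s, t') \<in> X_bar"
  obtain n where n: "T ((model ^^ n) (s, t)) - T ((model ^^ n) (s, t')) \<ge> 1"
    "T ((model ^^ Suc n) (s, t)) \<le> exp (T ((model ^^ n) (s, t))) / 2"
    using eventually_happens[OF eventually_conj[OF diff_potential_unbounded[OF X less] half]]
    by auto
  define a b where "a = T ((model ^^ n) (s, t))" and "b = T ((model ^^ n) (s, t'))"
  have "exp b * (5/2) \<le> exp b * exp 1"
    using exp_1_ge by (intro mult_left_mono) auto
  also have "\<dots> \<le> exp a"
    using n(1) by (simp add: a_def b_def flip: exp_add)
  finally have "exp b < exp a / 2"
    using exp_gt_zero[of b] by linarith
  moreover have "T ((model ^^ Suc n) (s, t')) = T ((model ^^ Suc n) (s, t)) + exp b - exp a"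
    unfolding T_model_funpow_Suc a_def b_def by simp
  ultimately have "T ((model ^^ Suc n) (s, t')) < 0"
    using n(2) by (simp add: a_def del: funpow.simps)
  then show False
    using X by (auto simp: X_bar_def not_le[symmetric] simp del: funpow.simps)
qed

section \<open>Greedy construction of the address\<close>

text \<open>
  Step \<open>m\<close> of the construction yields the address entry \<open>s m\<close> and the potential \<open>t\<^sub>m\<close>.
\<close>

fun tracking :: "(nat \<Rightarrow> real) \<Rightarrow> real \<Rightarrow> nat \<Rightarrow> nat \<Rightarrow> int \<times> real" where
  "tracking \<rho> x N 0 = (0, x)"
| "tracking \<rho> x N (Suc m) =
    (let y = F (snd (tracking \<rho> x N m));
         k = (if Suc m < N then 0 else \<lfloor>(y - (\<rho> (Suc m) + 1)) / (2 * pi)\<rfloor>)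
     in (k, y - 2 * pi * k))"

lemma tracking_address:
  fixes \<rho> :: "nat \<Rightarrow> real"
  assumes lim: "filterlim \<rho> at_top sequentially" and c: "c > 0"
    and growth: "\<And>n. \<rho> (Suc n) \<le> exp (\<rho> n) + c"
  obtains s t N where
    "\<And>n. T ((model ^^ n) (s, t)) \<ge> B"
    "\<And>n. n \<ge> N \<Longrightarrow> \<bar>T ((model ^^ n) (s, t)) - \<rho> n\<bar> \<le> 1 + 2 * pi"
    "\<And>n. n \<ge> N \<Longrightarrow> T ((model ^^ Suc n) (s, t)) \<le> exp (T ((model ^^ n) (s, t))) / 2"
    "\<And>n. n \<ge> N \<Longrightarrow> s (Suc n) \<ge> 2"
proof -
  \<comment> \<open>\<open>B\<close> is the required lower bound; \<open>10 * c + 100\<close>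
    absorbs \<open>c\<close> and the multiples of \<open>pi\<close> in the estimates below.\<close>
  define C where "C = max B (10 * c + 100)"
  have "\<forall>\<^sub>F n in sequentially. \<rho> n \<ge> C"
    using lim by (auto simp: filterlim_at_top)
  then obtain N0 where N0: "\<rho> n \<ge> C" if "n \<ge> N0" for n
    by (auto simp: eventually_sequentially)
  \<comment> \<open>The index must be positive, since the potential at index 0 is prescribed and not
    placed in a window.\<close>
  define N where "N = Suc N0"
  \<comment> \<open>The term \<open>\<rho> N + 3\<close> makes the first greedy entry
    non-negative.\<close>
  define x where "x = max C (\<rho> N + 3)"
  define s where "s m = fst (tracking \<rho> x N m)" for m
  define t where "t m = snd (tracking \<rho> x N m)" for m
  have t_0: "t 0 = x" by (simp add: t_def)
  have t_Suc: "t (Suc m) = exp (t m) - 1 - 2 * pi * s (Suc m)" for m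
    by (simp add: t_def s_def Let_def F_def)
  have s_Suc: "s (Suc m) = (if Suc m < N then 0 else \<lfloor>(exp (t m) - 1 - (\<rho> (Suc m) + 1)) / (2 * pi)\<rfloor>)"
    for m by (simp add: t_def s_def Let_def F_def)
  have pi4: "pi < 4" "pi > 3"
    using pi_less_4 pi_gt3 by auto
  have C_ge: "C \<ge> 10 * c + 100" "C \<ge> B" "C \<ge> 100"
    using c by (auto simp: C_def)
  have exp_quad: "exp y \<ge> y + 3" if "y \<ge> C" for y
  proof -
    have "y * y \<ge> 100 * y"
      using that C_ge by (intro mult_right_mono) auto
    then show ?thesis
      using exp_lower_Taylor_quadratic[of y] that C_ge unfolding power2_eq_square
      by linarith
  qed
  have early: "t m \<ge> x" if "m < N" for m
    using that
  proof (induction m)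
    case (Suc m)
    then have "t m \<ge> x" "s (Suc m) = 0" by (auto simp: s_Suc)
    then show ?case
      using exp_quad[of "t m"] by (simp add: t_Suc x_def)
  qed (simp add: t_0)
  have window: "\<rho> (Suc m) + 1 \<le> t (Suc m) \<and> t (Suc m) \<le> \<rho> (Suc m) + 1 + 2 * pi" if "Suc m \<ge> N" for m
  proof -
    let ?z = "exp (t m) - 1 - (\<rho> (Suc m) + 1)"
    have "2 * pi * real_of_int \<lfloor>?z / (2 * pi)\<rfloor> \<le> ?z"
      using floor_divide_lower[of "2 * pi" ?z] by (simp add: mult_ac)
    moreover have "?z < 2 * pi * (real_of_int \<lfloor>?z / (2 * pi)\<rfloor> + 1)"
      using floor_divide_upper[of "2 * pi" ?z] by (simp add: mult_ac)
    ultimately show ?thesis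
      using that unfolding t_Suc s_Suc by (simp add: algebra_simps)
  qed
  have late: "\<rho> m + 1 \<le> t m" "t m \<le> \<rho> m + 1 + 2 * pi" if "m \<ge> N" for m
    using window[of "m - 1"] that by (simp_all add: N_def)
  have late_C: "t m \<ge> C" if "m \<ge> N" for m
    using late(1)[OF that] N0[of m] that by (simp add: N_def)
  have ge_C: "t m \<ge> C" for m
    using late_C[of m] early[of m] by (cases "m < N") (auto simp: x_def)
  have exp_rho: "5/2 * exp (\<rho> m) \<le> exp (t m)" if "m \<ge> N" for m
  proof -
    have "5/2 * exp (\<rho> m) \<le> exp 1 * exp (\<rho> m)"
      using exp_1_ge by (intro mult_right_mono) auto
    also have "\<dots> \<le> exp (t m)"
      using late(1)[OF that] by (simp flip: exp_add)
    finally show ?thesis .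
  qed
  \<comment> \<open>The margin 1 gives \<open>exp (\<rho> m) \<le> 2/5 * exp (t m)\<close>; the
    remaining tenth of \<open>exp (t m)\<close> exceeds \<open>c + 1 + 2 * pi\<close>.\<close>
  have half: "t (Suc m) \<le> exp (t m) / 2" if "m \<ge> N" for m
    using late(2)[of "Suc m"] growth[of m] exp_rho[OF that] that exp_quad[OF ge_C[of m]] ge_C[of m]
      C_ge pi4 by linarith
  have s_ge_2: "s (Suc m) \<ge> 2" if "m \<ge> N" for m
  proof (rule ccontr)
    assume "\<not> s (Suc m) \<ge> 2"
    then have "2 * pi * real_of_int (s (Suc m)) \<le> 2 * pi * 1"
      by (intro mult_left_mono) auto
    then show False
      using half[OF that] t_Suc[of m] exp_quad[OF ge_C[of m]] ge_C[of m] C_ge pi4 by linarith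
  qed
  \<comment> \<open>The recursion subtracts the entry itself, the model map its absolute value; the
    sign reconciles them.\<close>
  have s_nonneg: "s (Suc m) \<ge> 0" for m
  proof (cases "m \<ge> N")
    case False
    then consider "Suc m < N" | "Suc m = N" by linarith
    then show ?thesis
    proof cases
      case 2
      then have "t m \<ge> x" using early[of m] by simp
      then have "exp (t m) - 1 - (\<rho> N + 1) \<ge> 0"
        using exp_quad[OF ge_C[of m]] by (simp add: x_def)
      then show ?thesis using 2 unfolding s_Suc by simp
    qed (simp add: s_Suc)
  qed (use s_ge_2[of m] in simp)
  have T_eq: "T ((model ^^ n) (s, x)) = t n" for n
  proof (induction n)
    case (Suc n)
    then show ?case
      unfolding T_model_funpow_Suc t_Suc using s_nonneg[of n] by simp
  qed (simp add: T_def t_0)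
  show thesis
  proof (rule that[of s x N])
    show "T ((model ^^ n) (s, x)) \<ge> B" for n
      unfolding T_eq using ge_C[of n] C_ge by simp
    show "\<bar>T ((model ^^ n) (s, x)) - \<rho> n\<bar> \<le> 1 + 2 * pi" if "n \<ge> N" for n
      unfolding T_eq using late[OF that] by simp
    show "T ((model ^^ Suc n) (s, x)) \<le> exp (T ((model ^^ n) (s, x))) / 2" if "n \<ge> N" for n
      unfolding T_eq using half[OF that] .
  qed (rule s_ge_2)
qed

section \<open>Sign change of the address and conclusion\<close>

lemma T_model_funpow_uminus:
  "T ((model ^^ n) (\<lambda>j. - s j, t)) = T ((model ^^ n) (s, t))"
proof (induction n)
  case (Suc n)
  then show ?case unfolding T_model_funpow_Suc by simp
qed (simp add: T_def)

theorem theorem1p4: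
  fixes \<kappa> :: complex and K :: real and r :: "nat \<Rightarrow> real" and c :: real
  assumes "K > 2 * pi + 6" and "cmod \<kappa> \<le> K"
    and "\<And>n. n \<ge> 1 \<Longrightarrow> r n > 0"
    and "filterlim r at_top sequentially"
    and "c > 0" and "\<And>n. n \<ge> 1 \<Longrightarrow> r (Suc n) \<le> exp (r n) + c"
  shows "\<exists>z n0. escaping_endpoint \<kappa> K z \<and> z \<in> escaping_set \<kappa> \<and> n0 \<ge> 1 \<and>
           (\<forall>n \<ge> n0. \<bar>Re ((E \<kappa> ^^ (n - 1)) z) - r n\<bar> \<le> 2 + 2 * pi)"
proof -
  note [simp del] = funpow.simps
  \<comment> \<open>The sequence \<open>r\<close> starts at index 1 and model orbits at 0, so
    \<open>\<rho> n\<close> is taken to be \<open>r (Suc n)\<close>.\<close>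
  have lim: "filterlim (\<lambda>n. r (Suc n)) at_top sequentially"
    using assms(4) by (simp add: filterlim_sequentially_Suc)
  obtain s t N where
    ge: "\<And>n. T ((model ^^ n) (s, t)) \<ge> max 0 (Q K)" and
    near: "\<And>n. n \<ge> N \<Longrightarrow> \<bar>T ((model ^^ n) (s, t)) - r (Suc n)\<bar> \<le> 1 + 2 * pi" and
    half: "\<And>n. n \<ge> N \<Longrightarrow> T ((model ^^ Suc n) (s, t)) \<le> exp (T ((model ^^ n) (s, t))) / 2" and
    s_ge: "\<And>n. n \<ge> N \<Longrightarrow> s (Suc n) \<ge> 2"
    using tracking_address[OF lim assms(5), of "max 0 (Q K)"] assms(6) by auto
  define p where "p \<epsilon> = (\<lambda>j. \<epsilon> * s j, t)" for \<epsilon> :: int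
  define sg :: "int set" where "sg = {1, -1}"
  have T_p: "T ((model ^^ n) (p \<epsilon>)) = T ((model ^^ n) (s, t))" if "\<epsilon> \<in> sg" for \<epsilon> n
    using that T_model_funpow_uminus[of n s t] by (auto simp: p_def sg_def)
  have escape: "filterlim (\<lambda>n. T ((model ^^ n) (s, t))) at_top sequentially"
  proof (rule filterlim_at_top_mono)
    show "filterlim (\<lambda>n. - (1 + 2 * pi) + r (Suc n)) at_top sequentially"
      by (rule filterlim_tendsto_add_at_top[OF tendsto_const lim])
    show "\<forall>\<^sub>F n in sequentially. - (1 + 2 * pi) + r (Suc n) \<le> T ((model ^^ n) (s, t))"
      using eventually_ge_at_top[of N]
    proof eventually_elim
      case (elim n)
      then show ?case using near[of n] by linarith
    qed
  qed
  have p_YX: "p \<epsilon> \<in> Y K \<inter> X" if "\<epsilon> \<in> sg" for \<epsilon>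
    using ge escape that by (auto simp: Y_def X_def X_bar_def T_p)
  have t_min: "t_min (fst (p \<epsilon>)) = ereal t" if \<epsilon>: "\<epsilon> \<in> sg" for \<epsilon>
  proof (rule t_min_eq)
    have eq: "(fst (p \<epsilon>), t) = p \<epsilon>" by (simp add: p_def)
    show "(fst (p \<epsilon>), t) \<in> X_bar"
      unfolding eq using p_YX[OF \<epsilon>] by (simp add: X_def)
    show "(fst (p \<epsilon>), t') \<notin> X_bar" if "t' < t" for t'
      by (rule not_X_bar_below[OF that])
         (auto simp: eq T_p[OF \<epsilon>] eventually_sequentially intro!: exI[of _ N] half
           simp del: funpow.simps le_divide_eq_numeral1)
  qed
  have "\<exists>\<epsilon>\<in>sg. p \<epsilon> \<in> g_dom \<kappa> K"
  proof (rule ccontr)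
    assume "\<not> ?thesis"
    then have not_dom: "p \<epsilon> \<notin> g_dom \<kappa> K" if "\<epsilon> \<in> sg" for \<epsilon>
      using that by blast
    \<comment> \<open>Outside the domain, some shift of the address of \<open>p \<epsilon>\<close>
      carries the value \<kappa>, so the orbit of \<kappa> reads off its entries.\<close>
    have "\<exists>n. \<forall>\<^sub>F j in sequentially.
        \<bar>Im ((E \<kappa> ^^ j) \<kappa>) - 2 * pi * real_of_int (\<epsilon> * s (n + j))\<bar> \<le> pi" if \<epsilon>: "\<epsilon> \<in> sg" for \<epsilon>
    proof -
      obtain s0 t0 n t' where g: "g_at \<kappa> K (s0, t0) \<kappa>" and n: "(model ^^ n) (p \<epsilon>) = (s0, t')"
        using not_dom[OF \<epsilon>] p_YX[OF \<epsilon>] by (auto simp: g_dom_def split: if_splits)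
      have "s0 j = \<epsilon> * s (n + j)" for j
        using fst_model_funpow[of n "p \<epsilon>" j] n by (simp add: p_def)
      then show ?thesis
        using g_at_itinerary[OF assms(1,2) g] by auto
    qed
    from this[of 1] this[of "-1"] obtain m n where
      "\<forall>\<^sub>F j in sequentially. \<bar>Im ((E \<kappa> ^^ j) \<kappa>) - 2 * pi * real_of_int (s (m + j))\<bar> \<le> pi"
      "\<forall>\<^sub>F j in sequentially. \<bar>Im ((E \<kappa> ^^ j) \<kappa>) + 2 * pi * real_of_int (s (n + j))\<bar> \<le> pi"
      by (auto simp: sg_def)
    then obtain j where j: "\<bar>Im ((E \<kappa> ^^ j) \<kappa>) - 2 * pi * real_of_int (s (m + j))\<bar> \<le> pi"
      "\<bar>Im ((E \<kappa> ^^ j) \<kappa>) + 2 * pi * real_of_int (s (n + j))\<bar> \<le> pi" "j \<ge> Suc N"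
      using eventually_happens[OF eventually_conj[OF _ eventually_conj[OF _ eventually_ge_at_top]]]
      by (metis (no_types, lifting) sequentially_bot)
    \<comment> \<open>Entries at least 2 force the imaginary part to be at least
      \<open>3 * pi\<close> for one sign and at most \<open>- 3 * pi\<close> for the other.\<close>
    have "s (k + j) \<ge> 2" for k
      using s_ge[of "k + j - 1"] j(3) by (cases j) auto
    then have "2 * pi * 2 \<le> 2 * pi * real_of_int (s (k + j))" for k
      by (intro mult_left_mono) auto
    from this[of m] this[of n] show False
      using j pi_gt_zero by linarith
  qed
  then obtain \<epsilon> where \<epsilon>: "\<epsilon> \<in> sg" and dom: "p \<epsilon> \<in> g_dom \<kappa> K" by blast
  note YX = p_YX[OF \<epsilon>]
  let ?z = "g_lim \<kappa> (p \<epsilon>)"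
  have eq: "(fst (p \<epsilon>), t) = p \<epsilon>" by (simp add: p_def)
  have "escaping_endpoint \<kappa> K ?z"
    unfolding escaping_endpoint_def
  proof (intro exI conjI)
    show "fast (fst (p \<epsilon>))"
      using YX by (simp add: fast_def exponentially_bounded_def t_min[OF \<epsilon>] eq)
  qed (use dom g_at_g_lim[OF assms(1,2) YX] in \<open>auto simp: t_min[OF \<epsilon>] eq\<close>)
  moreover have "?z \<in> escaping_set \<kappa>"
    by (rule g_lim_in_escaping_set[OF assms(1,2) YX])
  \<comment> \<open>The error is 1 from the box plus \<open>1 + 2 * pi\<close> from the
    window.\<close>
  moreover have "\<bar>Re ((E \<kappa> ^^ (n - 1)) ?z) - r n\<bar> \<le> 2 + 2 * pi" if "n \<ge> Suc N" for n
  proof -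
    let ?q = "(model ^^ (n - 1)) (p \<epsilon>)"
    have "(E \<kappa> ^^ (n - 1)) ?z \<in> box_around (Z ?q)"
      using g_lim_in_box_around[OF assms(1,2)] g_lim_funpow_model[OF assms(1,2)] YX by auto
    then have "\<bar>Re ((E \<kappa> ^^ (n - 1)) ?z) - T ((model ^^ (n - 1)) (s, t))\<bar> \<le> 1"
      using T_p[OF \<epsilon>, of "n - 1"] by (simp add: box_around_def Z_def T_def)
    then show ?thesis
      using near[of "n - 1"] that by (cases n) auto
  qed
  ultimately show ?thesis
    by (intro exI[of _ ?z] exI[of _ "Suc N"]) auto
qed

end
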